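(* For all NAA $S_1,S_2,S_3,S_4$ over a finite alphabet $\Sigma$, if $S_1\le_m S_3$ and $S_2\le_m S_4$ then $S_1\|S_2\le_m S_3\|S_4$.
   Context: A NAA is $(S,S^0,\mathrm{Tran})$, $S^0\subseteq S$ finite, $\mathrm{Tran}:S\to 2^{\mathcal P_{\mathrm{fin}}(\Sigma\times S)}$. NAA modal refinement $R\subseteq S_1\times S_2$: for $(s_1,s_2)\in R$ and $M_1\in\mathrm{Tran}_1(s_1)$ there is $M_2\in\mathrm{Tran}_2(s_2)$ such that each $(a,t_1)\in M_1$ has some $(a,t_2)\in M_2$ with $(t_1,t_2)\in R$ and each $(a,t_2)\in M_2$ has some $(a,t_1)\in M_1$ with $(t_1,t_2)\in R$; initialised if each initial state of the left NAA is related to some initial state of the right one. $S\le_m T$ iff an initialised modal refinement exists. Composition: $S_1\|S_2=(S_1\times S_2,S_1^0\times S_2^0,\mathrm{Tran})$ with $\mathrm{Tran}((s_1,s_2))=\{M_1\|M_2\mid M_1\in\mathrm{Tran}_1(s_1),M_2\in\mathrm{Tran}_2(s_2)\}$, $M_1\|M_2=\{(a,(t_1,t_2))\mid(a,t_1)\in M_1,(a,t_2)\in M_2\}$. *)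

theory Defs
  imports Main
begin

text \<open>
  Only the initial states and the members of each \<open>Tran s\<close> are required to be finite; the set of
  states is arbitrary. Values of \<open>tran\<close> outside \<open>states\<close> are irrelevant.
\<close>

record ('a, 's) naa =
  states :: "'s set"
  init :: "'s set"
  tran :: "'s \<Rightarrow> ('a \<times> 's) set set"

definition is_naa :: "'a set \<Rightarrow> ('a, 's) naa \<Rightarrow> bool" where
  "is_naa \<Sigma> A \<longleftrightarrow>
     init A \<subseteq> states A \<and> finite (init A) \<and>
     (\<forall>s\<in>states A. \<forall>M\<in>tran A s. finite M \<and> M \<subseteq> \<Sigma> \<times> states A)"

definition modal_refinement ::
  "('a, 's) naa \<Rightarrow> ('a, 't) naa \<Rightarrow> ('s \<times> 't) set \<Rightarrow> bool" where
  "modal_refinement A\<^sub>1 A\<^sub>2 R \<longleftrightarrow>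
     R \<subseteq> states A\<^sub>1 \<times> states A\<^sub>2 \<and>
     (\<forall>(s\<^sub>1, s\<^sub>2)\<in>R. \<forall>M\<^sub>1\<in>tran A\<^sub>1 s\<^sub>1. \<exists>M\<^sub>2\<in>tran A\<^sub>2 s\<^sub>2.
        (\<forall>(a, t\<^sub>1)\<in>M\<^sub>1. \<exists>t\<^sub>2. (a, t\<^sub>2) \<in> M\<^sub>2 \<and> (t\<^sub>1, t\<^sub>2) \<in> R) \<and>
        (\<forall>(a, t\<^sub>2)\<in>M\<^sub>2. \<exists>t\<^sub>1. (a, t\<^sub>1) \<in> M\<^sub>1 \<and> (t\<^sub>1, t\<^sub>2) \<in> R))"

definition initialised ::
  "('a, 's) naa \<Rightarrow> ('a, 't) naa \<Rightarrow> ('s \<times> 't) set \<Rightarrow> bool" where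
  "initialised A\<^sub>1 A\<^sub>2 R \<longleftrightarrow> (\<forall>s\<^sub>1\<in>init A\<^sub>1. \<exists>s\<^sub>2\<in>init A\<^sub>2. (s\<^sub>1, s\<^sub>2) \<in> R)"

definition refines :: "('a, 's) naa \<Rightarrow> ('a, 't) naa \<Rightarrow> bool" (infix "\<le>\<^sub>m" 50) where
  "A\<^sub>1 \<le>\<^sub>m A\<^sub>2 \<longleftrightarrow> (\<exists>R. modal_refinement A\<^sub>1 A\<^sub>2 R \<and> initialised A\<^sub>1 A\<^sub>2 R)"

definition set_comp :: "('a \<times> 's) set \<Rightarrow> ('a \<times> 't) set \<Rightarrow> ('a \<times> ('s \<times> 't)) set" where
  "set_comp M\<^sub>1 M\<^sub>2 = {(a, (t\<^sub>1, t\<^sub>2)) | a t\<^sub>1 t\<^sub>2. (a, t\<^sub>1) \<in> M\<^sub>1 \<and> (a, t\<^sub>2) \<in> M\<^sub>2}"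

definition naa_comp :: "('a, 's) naa \<Rightarrow> ('a, 't) naa \<Rightarrow> ('a, 's \<times> 't) naa"
    (infixr "\<parallel>" 65) where
  "A\<^sub>1 \<parallel> A\<^sub>2 =
     \<lparr>states = states A\<^sub>1 \<times> states A\<^sub>2,
      init = init A\<^sub>1 \<times> init A\<^sub>2,
      tran = (\<lambda>(s\<^sub>1, s\<^sub>2). {set_comp M\<^sub>1 M\<^sub>2 | M\<^sub>1 M\<^sub>2. M\<^sub>1 \<in> tran A\<^sub>1 s\<^sub>1 \<and> M\<^sub>2 \<in> tran A\<^sub>2 s\<^sub>2})\<rparr>"

lemma finite_set_comp:
  assumes "finite M\<^sub>1" and "finite M\<^sub>2"
  shows "finite (set_comp M\<^sub>1 M\<^sub>2)"
proof (rule finite_subset)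
  show "set_comp M\<^sub>1 M\<^sub>2 \<subseteq> (\<lambda>((a, t\<^sub>1), (b, t\<^sub>2)). (a, (t\<^sub>1, t\<^sub>2))) ` (M\<^sub>1 \<times> M\<^sub>2)"
    by (force simp: set_comp_def)
  show "finite ((\<lambda>((a, t\<^sub>1), (b, t\<^sub>2)). (a, (t\<^sub>1, t\<^sub>2))) ` (M\<^sub>1 \<times> M\<^sub>2))"
    using assms by simp
qed

lemma is_naa_naa_comp:
  assumes "is_naa \<Sigma> A\<^sub>1" and "is_naa \<Sigma> A\<^sub>2"
  shows "is_naa \<Sigma> (A\<^sub>1 \<parallel> A\<^sub>2)"
proof -
  have "finite (set_comp M\<^sub>1 M\<^sub>2) \<and> set_comp M\<^sub>1 M\<^sub>2 \<subseteq> \<Sigma> \<times> (states A\<^sub>1 \<times> states A\<^sub>2)"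
    if "s\<^sub>1 \<in> states A\<^sub>1" "s\<^sub>2 \<in> states A\<^sub>2" "M\<^sub>1 \<in> tran A\<^sub>1 s\<^sub>1" "M\<^sub>2 \<in> tran A\<^sub>2 s\<^sub>2" for s\<^sub>1 s\<^sub>2 M\<^sub>1 M\<^sub>2
  proof -
    have "finite M\<^sub>1" "M\<^sub>1 \<subseteq> \<Sigma> \<times> states A\<^sub>1" "finite M\<^sub>2" "M\<^sub>2 \<subseteq> \<Sigma> \<times> states A\<^sub>2"
      using assms that by (simp_all add: is_naa_def)
    then show ?thesis
      using finite_set_comp[of M\<^sub>1 M\<^sub>2] by (auto simp: set_comp_def)
  qed
  then have "\<forall>s\<in>states (A\<^sub>1 \<parallel> A\<^sub>2). \<forall>M\<in>tran (A\<^sub>1 \<parallel> A\<^sub>2) s.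
      finite M \<and> M \<subseteq> \<Sigma> \<times> states (A\<^sub>1 \<parallel> A\<^sub>2)"
    unfolding naa_comp_def by (clarsimp; blast)
  moreover have "init (A\<^sub>1 \<parallel> A\<^sub>2) \<subseteq> states (A\<^sub>1 \<parallel> A\<^sub>2)" "finite (init (A\<^sub>1 \<parallel> A\<^sub>2))"
    using assms by (auto simp: is_naa_def naa_comp_def)
  ultimately show ?thesis
    by (simp add: is_naa_def)
qed

end

theory Submission
  imports Defs
begin

text \<open>Composition is monotone because refinement can be answered in each component separately.
  Let \<open>R\<close> and \<open>Q\<close> witness the two given refinements, and relate composite
  states componentwise. A transition set of the left composite is a product of some
  \<open>M\<^sub>1\<close> and \<open>M\<^sub>2\<close>; \<open>R\<close> answers
  \<open>M\<^sub>1\<close> by some \<open>M\<^sub>3\<close>, \<open>Q\<close> answers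
  \<open>M\<^sub>2\<close> by some \<open>M\<^sub>4\<close>, and the product of
  \<open>M\<^sub>3\<close> and \<open>M\<^sub>4\<close> answers the whole. Matching never changes a
  label, so two elements that synchronise are matched by two that synchronise, in both directions.
  This is \<open>modal_refinement_naa_comp\<close>; \<open>initialised_naa_comp\<close> treats the
  initial states.\<close>

text \<open>The product of the two relations with the middle coordinates swapped:
  \<open>R \<times> Q\<close> would group each state with its refinement, whereas a relation between
  composites must group the two left states and the two right states.\<close>

definition rel_pair :: "('s1 \<times> 's3) set \<Rightarrow> ('s2 \<times> 's4) set \<Rightarrow> (('s1 \<times> 's2) \<times> ('s3 \<times> 's4)) set" where
  "rel_pair R Q = {((s\<^sub>1, s\<^sub>2), (s\<^sub>3, s\<^sub>4)) | s\<^sub>1 s\<^sub>2 s\<^sub>3 s\<^sub>4. (s\<^sub>1, s\<^sub>3) \<in> R \<and> (s\<^sub>2, s\<^sub>4) \<in> Q}"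

lemma modal_refinementE:
  assumes "modal_refinement A\<^sub>1 A\<^sub>2 R" and "(s\<^sub>1, s\<^sub>2) \<in> R" and "M\<^sub>1 \<in> tran A\<^sub>1 s\<^sub>1"
  obtains M\<^sub>2 where "M\<^sub>2 \<in> tran A\<^sub>2 s\<^sub>2"
    and "\<And>a t\<^sub>1. (a, t\<^sub>1) \<in> M\<^sub>1 \<Longrightarrow> \<exists>t\<^sub>2. (a, t\<^sub>2) \<in> M\<^sub>2 \<and> (t\<^sub>1, t\<^sub>2) \<in> R"
    and "\<And>a t\<^sub>2. (a, t\<^sub>2) \<in> M\<^sub>2 \<Longrightarrow> \<exists>t\<^sub>1. (a, t\<^sub>1) \<in> M\<^sub>1 \<and> (t\<^sub>1, t\<^sub>2) \<in> R"
  using assms unfolding modal_refinement_def by fast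

lemma modal_refinement_naa_comp:
  assumes R: "modal_refinement A\<^sub>1 A\<^sub>3 R" and Q: "modal_refinement A\<^sub>2 A\<^sub>4 Q"
  shows "modal_refinement (A\<^sub>1 \<parallel> A\<^sub>2) (A\<^sub>3 \<parallel> A\<^sub>4) (rel_pair R Q)"
proof -
  have "\<exists>N\<in>tran (A\<^sub>3 \<parallel> A\<^sub>4) (s\<^sub>3, s\<^sub>4).
      (\<forall>(a, t)\<in>M. \<exists>u. (a, u) \<in> N \<and> (t, u) \<in> rel_pair R Q) \<and>
      (\<forall>(a, u)\<in>N. \<exists>t. (a, t) \<in> M \<and> (t, u) \<in> rel_pair R Q)"
    if s: "(s\<^sub>1, s\<^sub>3) \<in> R" "(s\<^sub>2, s\<^sub>4) \<in> Q" and M: "M \<in> tran (A\<^sub>1 \<parallel> A\<^sub>2) (s\<^sub>1, s\<^sub>2)"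
    for s\<^sub>1 s\<^sub>2 s\<^sub>3 s\<^sub>4 M
  proof -
    \<comment> \<open>\<open>M\<close> may factor in several ways; any one factorisation will
      do.\<close>
    obtain M\<^sub>1 M\<^sub>2 where M12: "M = set_comp M\<^sub>1 M\<^sub>2" "M\<^sub>1 \<in> tran A\<^sub>1 s\<^sub>1" "M\<^sub>2 \<in> tran A\<^sub>2 s\<^sub>2"
      using M by (auto simp: naa_comp_def)
    obtain M\<^sub>3 where M3: "M\<^sub>3 \<in> tran A\<^sub>3 s\<^sub>3"
      "\<And>a t. (a, t) \<in> M\<^sub>1 \<Longrightarrow> \<exists>u. (a, u) \<in> M\<^sub>3 \<and> (t, u) \<in> R"
      "\<And>a u. (a, u) \<in> M\<^sub>3 \<Longrightarrow> \<exists>t. (a, t) \<in> M\<^sub>1 \<and> (t, u) \<in> R"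
      using modal_refinementE[OF R s(1) M12(2)] by metis
    obtain M\<^sub>4 where M4: "M\<^sub>4 \<in> tran A\<^sub>4 s\<^sub>4"
      "\<And>a t. (a, t) \<in> M\<^sub>2 \<Longrightarrow> \<exists>u. (a, u) \<in> M\<^sub>4 \<and> (t, u) \<in> Q"
      "\<And>a u. (a, u) \<in> M\<^sub>4 \<Longrightarrow> \<exists>t. (a, t) \<in> M\<^sub>2 \<and> (t, u) \<in> Q"
      using modal_refinementE[OF Q s(2) M12(3)] by metis
    show ?thesis
    proof (intro bexI conjI)
      show "set_comp M\<^sub>3 M\<^sub>4 \<in> tran (A\<^sub>3 \<parallel> A\<^sub>4) (s\<^sub>3, s\<^sub>4)"
        using M3(1) M4(1) by (auto simp: naa_comp_def)
      \<comment> \<open>Both components of an element of \<open>M\<close> carry the same label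
        \<open>a\<close>; their matches in \<open>M\<^sub>3\<close> and \<open>M\<^sub>4\<close>
        keep it and hence synchronise.\<close>
      show "\<forall>(a, t)\<in>M. \<exists>u. (a, u) \<in> set_comp M\<^sub>3 M\<^sub>4 \<and> (t, u) \<in> rel_pair R Q"
        using M3(2) M4(2) by (fastforce simp: M12(1) set_comp_def rel_pair_def)
      \<comment> \<open>The same argument backwards: the two components are traced to
        \<open>M\<^sub>1\<close> and \<open>M\<^sub>2\<close> under their common label.\<close>
      show "\<forall>(a, u)\<in>set_comp M\<^sub>3 M\<^sub>4. \<exists>t. (a, t) \<in> M \<and> (t, u) \<in> rel_pair R Q"
        using M3(3) M4(3) by (fastforce simp: M12(1) set_comp_def rel_pair_def)
    qed
  qed
  moreover have "rel_pair R Q \<subseteq> states (A\<^sub>1 \<parallel> A\<^sub>2) \<times> states (A\<^sub>3 \<parallel> A\<^sub>4)"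
    using R Q by (auto simp: modal_refinement_def naa_comp_def rel_pair_def)
  ultimately show ?thesis
    unfolding modal_refinement_def by (auto simp: rel_pair_def)
qed

text \<open>Initial states of a composite are arbitrary pairs of initial states, so independently
  chosen partners again form an initial state.\<close>

lemma initialised_naa_comp:
  assumes "initialised A\<^sub>1 A\<^sub>3 R" and "initialised A\<^sub>2 A\<^sub>4 Q"
  shows "initialised (A\<^sub>1 \<parallel> A\<^sub>2) (A\<^sub>3 \<parallel> A\<^sub>4) (rel_pair R Q)"
  using assms by (fastforce simp: initialised_def naa_comp_def rel_pair_def)

theorem theorem5:
  fixes \<Sigma> :: "'a set"
    and S\<^sub>1 :: "('a, 's1) naa" and S\<^sub>2 :: "('a, 's2) naa"
    and S\<^sub>3 :: "('a, 's3) naa" and S\<^sub>4 :: "('a, 's4) naa"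
  assumes "finite \<Sigma>"
    and "is_naa \<Sigma> S\<^sub>1" and "is_naa \<Sigma> S\<^sub>2" and "is_naa \<Sigma> S\<^sub>3" and "is_naa \<Sigma> S\<^sub>4"
    and "S\<^sub>1 \<le>\<^sub>m S\<^sub>3" and "S\<^sub>2 \<le>\<^sub>m S\<^sub>4"
  shows "S\<^sub>1 \<parallel> S\<^sub>2 \<le>\<^sub>m S\<^sub>3 \<parallel> S\<^sub>4"
  using assms(6,7) modal_refinement_naa_comp initialised_naa_comp
  unfolding refines_def by metis

end
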